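(* Let $K(x;\alpha,\beta)=\frac{1}{\Gamma(\alpha)\beta^\alpha}x^{\alpha-1}e^{-x/\beta}$, $x>0$, $\alpha>0$, $\beta>0$, be the gamma kernel, let $\Pi$ be a prior on $\mathscr{M}(\mathbb{R}^+\times\mathbb{R}^+)$, and let $\Pi^*$ be the prior induced by $\Pi$ on densities via $P\mapsto f_P$, $f_P(x)=\int K(x;\alpha,\beta)\,dP(\alpha,\beta)$. Assume that the weak support of $\Pi$ is $\mathscr{M}(\mathbb{R}^+\times\mathbb{R}^+)$. Let $f_0$ be a continuous and bounded density on $[0,\infty)$ satisfying (B4) for some $0<M<\infty$, $0<f_0(x)\le M$ for all $x>0$; (B5) $\left|\int f_0(x)\log f_0(x)\,dx\right|<\infty$; (B6* ) $\int f_0(x)\log\frac{f_0(x)}{\phi_\delta(x)}\,dx<\infty$ for some $\delta>0$, where $\phi_\delta(x)=\inf_{t\in[x,x+\delta)}f_0(t)$ for $0<x<1$ and $\phi_\delta(x)=\inf_{t\in(x-\delta,x]}f_0(t)$ for $x\ge1$; (B7* ) there exists $\eta>0$ such that $\int\max(x^{-\eta-2},x^{\eta+2})f_0(x)\,dx<\infty$. Then $f_0\in\mathrm{KL}(\Pi^* )$.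
   Context: $\mathbb{R}^+=(0,\infty)$. $\mathscr{M}(S)$ is the set of probability measures on $S$; a prior is a probability measure on the indicated space; the weak support of a prior on $\mathscr{M}(S)$ is its support in the topology of weak convergence. Infima are over points $t$ in the domain of $f_0$. $f_0\in\mathrm{KL}(\Pi^* )$ means $\Pi^*(\{f:\int f_0\log(f_0/f)<\epsilon\})>0$ for every $\epsilon>0$. *)

theory Defs
  imports "HOL-Probability.Probability"
begin

text \<open>Probability measures on a subset \<open>A\<close> of a topological space with its Borel sets. They carry
  the sigma-algebra generated by the evaluations \<open>P \<mapsto> P(B)\<close>; for separable metric \<open>A\<close> this is
  also the Borel sigma-algebra of the weak topology below, so that weakly open sets are measurable.\<close>

definition prob_measures_algebra :: "'a::topological_space set \<Rightarrow> 'a measure measure" where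
  "prob_measures_algebra A = prob_algebra (restrict_space borel A)"

definition weak_topology :: "'a::topological_space set \<Rightarrow> 'a measure topology" where
  "weak_topology A = topology_generated_by
     {{P \<in> space (prob_measures_algebra A). (\<integral>x. g x \<partial>P) \<in> U} | (g :: 'a \<Rightarrow> real) U.
        continuous_on A g \<and> bounded (g ` A) \<and> open U}"

definition prior_on :: "'a::topological_space set \<Rightarrow> 'a measure measure \<Rightarrow> bool" where
  "prior_on A \<mu> \<longleftrightarrow> prob_space \<mu> \<and> sets \<mu> = sets (prob_measures_algebra A)"

definition weak_support :: "'a::topological_space set \<Rightarrow> 'a measure measure \<Rightarrow> 'a measure set" where
  "weak_support A \<mu> = {P \<in> space (prob_measures_algebra A).
     \<forall>U. openin (weak_topology A) U \<and> P \<in> U \<longrightarrow> emeasure \<mu> U > 0}"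

text \<open>Values of \<open>f\<close> outside \<open>A\<close> are irrelevant.\<close>

definition densities_on :: "real set \<Rightarrow> (real \<Rightarrow> real) set" where
  "densities_on A = {f \<in> borel_measurable (restrict_space borel A).
     (\<forall>x\<in>A. 0 \<le> f x) \<and> (\<integral>\<^sup>+x\<in>A. ennreal (f x) \<partial>lborel) = 1}"

text \<open>Meaningful for \<open>x, \<alpha>, \<beta> > 0\<close> only.\<close>

definition gamma_kernel :: "real \<Rightarrow> real \<Rightarrow> real \<Rightarrow> real" where
  "gamma_kernel x \<alpha> \<beta> = 1 / (Gamma \<alpha> * \<beta> powr \<alpha>) * x powr (\<alpha> - 1) * exp (- x / \<beta>)"

text \<open>The integral below can diverge, but only for \<open>x\<close> in a Lebesgue null set (depending on \<open>P\<close>),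
  where the library's convention gives it the value 0.\<close>

definition gamma_mixture :: "(real \<times> real) measure \<Rightarrow> real \<Rightarrow> real" where
  "gamma_mixture P x = (\<integral>(\<alpha>, \<beta>). gamma_kernel x \<alpha> \<beta> \<partial>P)"

text \<open>Image measure of \<open>\<mu>\<close> under a map \<open>T\<close> into \<open>D\<close>, on the sigma-algebra of all subsets of \<open>D\<close>
  whose preimage is measurable.\<close>

definition induced_prior :: "'a measure \<Rightarrow> 'b set \<Rightarrow> ('a \<Rightarrow> 'b) \<Rightarrow> 'b measure" where
  "induced_prior \<mu> D T = distr \<mu> (sigma D {B. B \<subseteq> D \<and> T -` B \<inter> space \<mu> \<in> sets \<mu>}) T"

text \<open>The expression \<open>a log (a / b)\<close> for \<open>a, b \<ge> 0\<close> with its usual extended values, which differ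
  from what \<open>a / 0 = 0\<close> and \<open>ln 0 = 0\<close> would give when \<open>b = 0\<close>.\<close>

definition log_ratio_term :: "real \<Rightarrow> real \<Rightarrow> ereal" where
  "log_ratio_term a b = (if a = 0 then 0 else if b = 0 then \<infinity> else ereal (a * ln (a / b)))"

text \<open>The extended integral of \<open>f log (f / g)\<close> over the positive half-line, as positive part minus
  negative part. Since \<open>\<infinity> - \<infinity> = \<infinity>\<close> in type \<open>ereal\<close>, a value below \<open>\<infinity>\<close> entails that the
  positive part has a finite integral.\<close>

definition log_ratio_integral :: "(real \<Rightarrow> real) \<Rightarrow> (real \<Rightarrow> real) \<Rightarrow> ereal" where
  "log_ratio_integral f g =
     enn2ereal (\<integral>\<^sup>+x\<in>{0<..}. e2ennreal (log_ratio_term (f x) (g x)) \<partial>lborel) -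
     enn2ereal (\<integral>\<^sup>+x\<in>{0<..}. e2ennreal (- log_ratio_term (f x) (g x)) \<partial>lborel)"

definition KL_support :: "(real \<Rightarrow> real) measure \<Rightarrow> (real \<Rightarrow> real) set" where
  "KL_support \<mu> = {f0. \<forall>\<epsilon>>0. emeasure \<mu> {f \<in> space \<mu>. log_ratio_integral f0 f < ereal \<epsilon>} > 0}"

text \<open>The intersection with \<open>{0..}\<close> reflects that \<open>f0\<close> is a function on \<open>[0, \<infinity>)\<close>.\<close>

definition local_inf :: "(real \<Rightarrow> real) \<Rightarrow> real \<Rightarrow> real \<Rightarrow> real" where
  "local_inf f0 \<delta> x =
     (if x < 1 then INF t\<in>{x..<x + \<delta>} \<inter> {0..}. f0 t else INF t\<in>{x - \<delta><..x} \<inter> {0..}. f0 t)"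

end

theory Submission imports Defs begin

text \<open>
  The prior charges every nonempty weakly open set of mixing measures. So it suffices to find, for
  each \<open>\<epsilon> > 0\<close>, a nonempty weakly open set \<open>U\<close> such that the divergence of \<open>f0\<close> from \<open>f\<^sub>P\<close> is below \<open>\<epsilon>\<close>
  for \<^emph>\<open>all\<close> \<open>P \<in> U\<close>. The set \<open>U\<close> is a neighbourhood of a discrete measure with finitely many atoms of
  two kinds, which bound the mixtures from below on a compact interval \<open>[a, b]\<close> and on its
  complement.

  On \<open>[a, b]\<close>: the gamma kernel with shape \<open>j + 1\<close> and scale \<open>1 / n\<close> is, as a function of \<open>x\<close>, equal to
  \<open>n\<close> times the Poisson weight of \<open>j\<close> for the mean \<open>n x\<close>. Placing the mass of \<open>f0\<close> on
  \<open>[j / n, (j + 1) / n)\<close> at the point \<open>(j + 1, 1 / n)\<close> for each \<open>j\<close> therefore produces the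
  Szasz-Mirakyan-Kantorovich approximation of \<open>f0\<close>. Since the Poisson law for \<open>n x\<close>, rescaled by
  \<open>1 / n\<close>, concentrates at \<open>x\<close> by Chebyshev's inequality, it is at least \<open>\<kappa> f0\<close> on \<open>[a, b]\<close>
  for large \<open>n\<close>, whatever \<open>\<kappa> < 1\<close> (lemma \<open>szasz_kantorovich_lower_bound\<close>).

  Off \<open>[a, b]\<close>: one more atom, of mass at least \<open>1 - \<kappa>\<close>, sits at \<open>(1 / 2, 2)\<close>. For all parameters near it
  the kernel is at least \<open>c exp (- 2 x)\<close> on the whole half-line
  (lemma \<open>gamma_kernel_exponential_lower_bound\<close>), which gives a lower bound \<open>d exp (- 2 x)\<close> for
  the mixture, with \<open>d\<close> depending on \<open>\<kappa>\<close> only.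

  Both bounds survive, up to factors \<open>\<kappa>\<close>, for all \<open>P\<close> in a weak neighbourhood: continuous tents
  around the atoms test how much mass \<open>P\<close> has near each of them, and near an atom the kernel changes by
  a factor close to 1, uniformly on \<open>[a, b]\<close>
  (lemma \<open>weak_neighbourhood_with_large_mixtures\<close>). Consequently the divergence is at most
  \<open>ln (1 / \<kappa> ^ 4)\<close> plus the integral of \<open>f0 (ln f0 + 2 x - ln d)\<close> over the complement of \<open>[a, b]\<close>. Here
  \<open>f0 ln f0\<close>, \<open>x f0\<close> and \<open>f0\<close> are integrable, so the second part becomes small for a large interval. The
  order of the choices matters: first \<open>\<kappa>\<close>, which fixes \<open>d\<close>, then \<open>[a, b]\<close>, and then \<open>n\<close> and
  the atoms.

  Finally, the set of mixing measures with divergence below \<open>\<epsilon>\<close> must be measurable. The mixture is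
  jointly measurable in the mixing measure and the point as a nonnegative integral, and by Tonelli
  this integral is finite almost everywhere with total mass 1, so that it agrees with the real-valued
  mixture up to a null set, on which the divergence does not depend.
\<close>

abbreviation (input) quadrant :: "(real \<times> real) set" where
  "quadrant \<equiv> {0<..} \<times> {0<..}"

section \<open>The gamma kernel\<close>

lemma gamma_kernel_nonneg: "0 < \<alpha> \<Longrightarrow> 0 \<le> gamma_kernel x \<alpha> \<beta>"
  by (simp add: gamma_kernel_def)

lemma gamma_kernel_pos: "0 < x \<Longrightarrow> 0 < \<alpha> \<Longrightarrow> 0 < \<beta> \<Longrightarrow> 0 < gamma_kernel x \<alpha> \<beta>"
  by (simp add: gamma_kernel_def Gamma_real_pos)

lemma continuous_on_gamma_kernel:
  "continuous_on ({0<..} \<times> ({0<..} \<times> {0<..})) (\<lambda>(x, \<alpha>, \<beta>). gamma_kernel x \<alpha> \<beta>)"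
proof -
  have ne: "Gamma a \<noteq> 0" if "0 < a" for a :: real using Gamma_real_pos[OF that] by simp
  have nn: "a \<notin> \<int>\<^sub>\<le>\<^sub>0" if "0 < a" for a :: real using that by (auto elim: nonpos_Ints_cases)
  have Gg: "continuous_on {0<..} (Gamma :: real \<Rightarrow> real)"
    by (intro continuous_on_Gamma) (auto simp: nn)
  show ?thesis
    unfolding gamma_kernel_def split_beta
    by (intro continuous_intros continuous_on_compose2[OF Gg]) (auto simp: ne nn)
qed

text \<open>The substitution \<open>x = \<beta> t\<close> turns this into the Gamma integral.\<close>

lemma nn_integral_gamma_kernel:
  assumes "0 < \<alpha>" "0 < \<beta>"
  shows "(\<integral>\<^sup>+x\<in>{0<..}. ennreal (gamma_kernel x \<alpha> \<beta>) \<partial>lborel) = 1"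
proof -
  have G: "0 < Gamma \<alpha>" using assms by (simp add: Gamma_real_pos)
  have "ennreal \<beta> * (\<integral>\<^sup>+x. indicator {0<..} (0 + \<beta> * x) * ennreal (gamma_kernel (0 + \<beta> * x) \<alpha> \<beta>) \<partial>lborel)
     = ennreal (1 / Gamma \<alpha>) * (\<integral>\<^sup>+x. ennreal (indicator {0..} x * x powr (\<alpha> - 1) / exp x) \<partial>lborel)"
  proof (subst (1 2) nn_integral_cmult[symmetric])
    show "(\<integral>\<^sup>+ x. ennreal \<beta> * (indicator {0<..} (0 + \<beta> * x) * ennreal (gamma_kernel (0 + \<beta> * x) \<alpha> \<beta>)) \<partial>lborel) =
      (\<integral>\<^sup>+ x. ennreal (1 / Gamma \<alpha>) * ennreal (indicator {0..} x * x powr (\<alpha> - 1) / exp x) \<partial>lborel)"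
    proof (rule nn_integral_cong)
      fix x :: real
      show "ennreal \<beta> * (indicator {0<..} (0 + \<beta> * x) * ennreal (gamma_kernel (0 + \<beta> * x) \<alpha> \<beta>)) =
        ennreal (1 / Gamma \<alpha>) * ennreal (indicator {0..} x * x powr (\<alpha> - 1) / exp x)"
      proof (cases "0 < x")
        case True
        have "\<beta> * gamma_kernel (\<beta> * x) \<alpha> \<beta> = 1 / Gamma \<alpha> * (x powr (\<alpha> - 1) / exp x)"
          using True assms G
          by (simp add: gamma_kernel_def powr_mult powr_diff exp_minus field_simps)
        then show ?thesis using True assms G
          by (simp add: ennreal_mult'[symmetric] gamma_kernel_nonneg)
      next
        case False
        then show ?thesis using assms by (auto simp: indicator_def zero_less_mult_iff not_less)
      qed
    qed
  qed (unfold gamma_kernel_def, measurable)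
  also have "\<dots> = 1"
    using assms G by (subst Gamma_conv_nn_integral_real[symmetric])
       (simp_all only: ennreal_mult'[symmetric] divide_nonneg_pos zero_le_one, simp add: less_imp_neq[OF G, symmetric])
  finally have *: "ennreal \<beta> * (\<integral>\<^sup>+x. indicator {0<..} (0 + \<beta> * x) * ennreal (gamma_kernel (0 + \<beta> * x) \<alpha> \<beta>) \<partial>lborel) = 1" .
  have "(\<integral>\<^sup>+x. indicator {0<..} x * ennreal (gamma_kernel x \<alpha> \<beta>) \<partial>lborel) = 1"
  proof (subst nn_integral_real_affine[where c = \<beta> and t = 0])
    show "(\<lambda>x. indicator {0<..} x * ennreal (gamma_kernel x \<alpha> \<beta>)) \<in> borel_measurable borel"
      unfolding gamma_kernel_def by measurable
    show "ennreal \<bar>\<beta>\<bar> * (\<integral>\<^sup>+x. indicator {0<..} (0 + \<beta> * x) * ennreal (gamma_kernel (0 + \<beta> * x) \<alpha> \<beta>) \<partial>lborel) = 1"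
      unfolding abs_of_pos[OF assms(2)] by (rule *)
  qed (use assms in simp)
  then show ?thesis by (simp only: mult.commute)
qed

text \<open>For \<open>x\<close> in a compact interval the kernel at \<open>z\<close> is bounded away from 0, so uniform continuity
  gives a comparison with a factor instead of an additive error. The filter allows one radius to be
  chosen for finitely many points \<open>z\<close>.\<close>

lemma gamma_kernel_eventually_ge:
  assumes z: "z \<in> {0<..} \<times> {0<..}" and ab: "0 < a" "a \<le> b" and \<kappa>: "\<kappa> < 1"
  shows "\<forall>\<^sub>F r in at_right 0. \<forall>x\<in>{a..b}. \<forall>y. dist y z < r \<longrightarrow>
    \<kappa> * gamma_kernel x (fst z) (snd z) \<le> gamma_kernel x (fst y) (snd y)"
proof -
  let ?K = "\<lambda>(x, \<alpha>, \<beta>). gamma_kernel x \<alpha> \<beta>"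
  have "open ({0<..} \<times> {0<..} :: (real \<times> real) set)" by (intro open_Times open_greaterThan)
  then obtain e where e: "0 < e" "cball z e \<subseteq> {0<..} \<times> {0<..}"
    using z open_contains_cball_eq by blast
  have sub: "{a..b} \<times> cball z e \<subseteq> {0<..} \<times> {0<..} \<times> {0<..}" using e ab by auto
  then have cont: "continuous_on ({a..b} \<times> cball z e) ?K"
    using continuous_on_gamma_kernel by (rule continuous_on_subset[rotated])
  have "continuous_on {a..b} (\<lambda>x. ?K (x, z))"
    by (rule continuous_on_compose2[OF cont]) (use e in \<open>auto intro!: continuous_intros\<close>)
  then obtain x0 where x0: "x0 \<in> {a..b}" "\<And>x. x \<in> {a..b} \<Longrightarrow> ?K (x0, z) \<le> ?K (x, z)"
    using continuous_attains_inf[of "{a..b}" "\<lambda>x. ?K (x, z)"] ab by auto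
  have "0 < ?K (x0, z)" using x0 z ab by (auto simp: split_beta intro!: gamma_kernel_pos)
  then have "0 < (1 - \<kappa>) * ?K (x0, z)" using \<kappa> by simp
  moreover have "uniformly_continuous_on ({a..b} \<times> cball z e) ?K"
    using cont by (intro compact_uniformly_continuous compact_Times) auto
  ultimately obtain d where d: "0 < d"
    "\<And>u v. u \<in> {a..b} \<times> cball z e \<Longrightarrow> v \<in> {a..b} \<times> cball z e \<Longrightarrow> dist v u < d
      \<Longrightarrow> dist (?K v) (?K u) < (1 - \<kappa>) * ?K (x0, z)"
    unfolding uniformly_continuous_on_def by metis
  have "\<kappa> * gamma_kernel x (fst z) (snd z) \<le> gamma_kernel x (fst y) (snd y)"
    if x: "x \<in> {a..b}" and y: "dist y z < r" and r: "r < min d e" for x y r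
  proof -
    have "dist (?K (x, y)) (?K (x, z)) < (1 - \<kappa>) * ?K (x0, z)"
      using x y r e by (intro d) (auto simp: dist_commute dist_Pair_Pair)
    moreover have "(1 - \<kappa>) * ?K (x0, z) \<le> (1 - \<kappa>) * ?K (x, z)"
      using x0(2)[OF x] \<kappa> by (intro mult_left_mono) auto
    ultimately show ?thesis by (auto simp: dist_real_def split_beta algebra_simps)
  qed
  then show ?thesis
    using d e unfolding eventually_at_right_field by (intro exI[of _ "min d e"]) auto
qed

text \<open>The shapes near \<open>1 / 2\<close> are below 1, so the power \<open>x powr (\<alpha> - 1)\<close> does not vanish at the
  origin and decays more slowly than \<open>1 / x\<close> at infinity: it dominates \<open>exp (- x)\<close> everywhere. The scales
  near 2 exceed 1, so the exponential factor dominates \<open>exp (- x)\<close> as well.\<close>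

lemma gamma_kernel_exponential_lower_bound:
  "\<exists>c>0. \<forall>x>0. \<forall>y. dist y (1 / 2, 2) < 1 / 4 \<longrightarrow> c * exp (- 2 * x) \<le> gamma_kernel x (fst y) (snd y)"
proof -
  \<comment> \<open>The constant is the minimum of the kernel at \<open>x = 1\<close>, which is
    \<open>exp (- 1 / \<beta>) / (Gamma \<alpha> * \<beta> powr \<alpha>)\<close>; this is why the factor \<open>exp (1 / \<beta>)\<close> appears below.\<close>
  let ?B = "{1 / 4..3 / 4} \<times> {1..3} :: (real \<times> real) set"
  let ?g = "\<lambda>y :: real \<times> real. gamma_kernel 1 (fst y) (snd y)"
  have "continuous_on ?B ?g"
    by (rule continuous_on_compose2[OF continuous_on_gamma_kernel, of _ "\<lambda>y. (1, y)", unfolded split_beta fst_conv snd_conv])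
       (auto intro!: continuous_intros)
  moreover have "compact ?B" "?B \<noteq> {}" by (auto intro!: compact_Times)
  ultimately obtain y0 where y0: "y0 \<in> ?B" "\<And>y. y \<in> ?B \<Longrightarrow> ?g y0 \<le> ?g y"
    using continuous_attains_inf[of ?B ?g] by blast
  show ?thesis
  proof (intro exI[of _ "?g y0"] conjI allI impI)
    show "0 < ?g y0" using y0 by (auto intro!: gamma_kernel_pos)
    fix x :: real and y :: "real \<times> real" assume x: "0 < x" and y: "dist y (1 / 2, 2) < 1 / 4"
    obtain \<alpha> \<beta> where [simp]: "y = (\<alpha>, \<beta>)" by (cases y)
    have "dist \<alpha> (1/2) < 1 / 4" "dist \<beta> 2 < 1 / 4"
      using le_less_trans[OF dist_fst_le y] le_less_trans[OF dist_snd_le y] by auto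
    then have ab: "\<alpha> \<in> {1/4..3/4}" "\<beta> \<in> {1..3}"
      unfolding dist_real_def abs_less_iff atLeastAtMost_iff by linarith+
    have "exp (- x) \<le> x powr (\<alpha> - 1)"
    proof -
      have "(\<alpha> - 1) * ln x \<ge> - x"
      proof (cases "x \<le> 1")
        case True
        then have "0 \<le> (\<alpha> - 1) * ln x" using ab x by (intro mult_nonpos_nonpos) auto
        then show ?thesis using x by linarith
      next
        case False
        then have "(1 - \<alpha>) * ln x \<le> 1 * ln x" using ab by (intro mult_right_mono) auto
        also have "\<dots> \<le> x" using ln_bound[of x] x by simp
        finally show ?thesis by (simp add: algebra_simps)
      qed
      then show ?thesis using x by (simp add: powr_def)
    qed
    moreover have "exp (- x) \<le> exp (1 / \<beta>) * exp (- x / \<beta>)"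
    proof -
      have "- x \<le> - x / \<beta>" using x ab by (simp add: field_simps)
      then have "- x \<le> 1 / \<beta> + - x / \<beta>" using ab by (smt (verit) atLeastAtMost_iff zero_le_divide_1_iff)
      then show ?thesis by (simp add: exp_add[symmetric])
    qed
    ultimately have "exp (- x) * exp (- x) \<le> x powr (\<alpha> - 1) * (exp (1 / \<beta>) * exp (- x / \<beta>))"
      by (intro mult_mono) auto
    then have "?g y * exp (- 2 * x) \<le> ?g y * (x powr (\<alpha> - 1) * (exp (1 / \<beta>) * exp (- x / \<beta>)))"
      using ab by (intro mult_left_mono) (auto simp: exp_add[symmetric] intro!: gamma_kernel_nonneg)
    also have "\<dots> = gamma_kernel x \<alpha> \<beta>"
      by (simp add: gamma_kernel_def exp_minus)
    finally have "?g y * exp (- 2 * x) \<le> gamma_kernel x \<alpha> \<beta>" .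
    moreover have "?g y0 * exp (- 2 * x) \<le> ?g y * exp (- 2 * x)"
      using ab y0(2)[of y] by (intro mult_right_mono) auto
    ultimately have "?g y0 * exp (- 2 * x) \<le> gamma_kernel x \<alpha> \<beta>" by (rule order_trans[rotated])
    then show "?g y0 * exp (- 2 * x) \<le> gamma_kernel x (fst y) (snd y)" by simp
  qed
qed

section \<open>Approximation by mixtures of gamma kernels with integer shapes\<close>

lemma poisson_sums_1:
  fixes y :: real
  shows "(\<lambda>j. y ^ j / fact j * exp (- y)) sums 1"
proof -
  have "(\<lambda>j. y ^ j / fact j) sums exp y"
    using exp_converges[of y] by (simp add: scaleR_conv_of_real divide_inverse mult.commute)
  from sums_mult2[OF this, of "exp (- y)"] show ?thesis
    by (simp add: exp_minus)
qed

text \<open>The mean and the second moment both follow by shifting the summation index with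
  \<open>j p\<^sub>j = y p\<^sub>j\<^sub>-\<^sub>1\<close>.\<close>

lemma poisson_variance:
  fixes y :: real
  shows "(\<lambda>j. (real j - y)\<^sup>2 * (y ^ j / fact j * exp (- y))) sums y"
proof -
  let ?p = "\<lambda>j. y ^ j / fact j * exp (- y)"
  have step: "real (Suc j) * ?p (Suc j) = y * ?p j" for j
    by (simp del: of_nat_Suc)
  have s1: "(\<lambda>j. real j * ?p j) sums y"
  proof -
    have "(\<lambda>j. real (Suc j) * ?p (Suc j)) sums y"
      unfolding step using sums_mult[OF poisson_sums_1[of y], of y] by simp
    then show ?thesis using sums_Suc_iff[of "\<lambda>j. real j * ?p j"] by simp
  qed
  have s2: "(\<lambda>j. real j * (real j * ?p j)) sums (y * (y + 1))"
  proof -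
    have "real (Suc j) * (real (Suc j) * ?p (Suc j)) = y * (real j * ?p j + ?p j)" for j
      unfolding step by (simp only: of_nat_Suc distrib_left distrib_right mult_1 mult_1_right mult_ac)
    then have "(\<lambda>j. real (Suc j) * (real (Suc j) * ?p (Suc j))) sums (y * (y + 1))"
      using sums_mult[OF sums_add[OF s1 poisson_sums_1[of y]], of y] by presburger
    then show ?thesis using sums_Suc_iff[of "\<lambda>j. real j * (real j * ?p j)"] by simp
  qed
  have eq: "real j * (real j * ?p j) + ((- 2 * y) * (real j * ?p j) + y\<^sup>2 * ?p j)
      = (real j - y)\<^sup>2 * ?p j" for j
    unfolding power2_eq_square by (simp only: algebra_simps)
  have "(\<lambda>j. real j * (real j * ?p j) + ((- 2 * y) * (real j * ?p j) + y\<^sup>2 * ?p j))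
     sums (y * (y + 1) + ((- 2 * y) * y + y\<^sup>2 * 1))"
    by (intro sums_mult sums_add s1 s2 poisson_sums_1)
  then have "(\<lambda>j. (real j - y)\<^sup>2 * ?p j) sums (y * (y + 1) + ((- 2 * y) * y + y\<^sup>2 * 1))"
    unfolding eq .
  moreover have "y * (y + 1) + ((- 2 * y) * y + y\<^sup>2 * 1) = y"
    by (simp add: power2_eq_square algebra_simps)
  ultimately show ?thesis by (simp only:)
qed

text \<open>Chebyshev's inequality, in the form of a lower bound for the mass of any finite set that contains
  all natural numbers within distance \<open>s\<close> of the mean \<open>y\<close>.\<close>

lemma poisson_chebyshev:
  fixes y s :: real and J :: "nat set"
  assumes "0 \<le> y" "0 < s" "finite J" and J: "\<And>j. \<bar>real j - y\<bar> < s \<Longrightarrow> j \<in> J"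
  shows "1 - y / s\<^sup>2 \<le> (\<Sum>j\<in>J. y ^ j / fact j * exp (- y))"
proof -
  let ?p = "\<lambda>j. y ^ j / fact j * exp (- y)"
  \<comment> \<open>Termwise, \<open>1 - (j - y)\<^sup>2 / s\<^sup>2\<close> is at most the indicator of \<open>J\<close>.\<close>
  have "(\<lambda>j. ?p j - (real j - y)\<^sup>2 * ?p j / s\<^sup>2) sums (1 - y / s\<^sup>2)"
    by (intro sums_diff poisson_sums_1 sums_divide poisson_variance)
  moreover have "(\<lambda>j. if j \<in> J then ?p j else 0) sums (\<Sum>j\<in>J. ?p j)"
    using \<open>finite J\<close> by (rule sums_If_finite_set)
  moreover have "?p j - (real j - y)\<^sup>2 * ?p j / s\<^sup>2 \<le> (if j \<in> J then ?p j else 0)" for j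
  proof -
    have p0: "0 \<le> ?p j" using assms(1) by simp
    show ?thesis
    proof (cases "j \<in> J")
      case True
      have "0 \<le> (real j - y)\<^sup>2 * ?p j / s\<^sup>2" by (intro divide_nonneg_nonneg mult_nonneg_nonneg p0) auto
      then show ?thesis using True by simp
    next
      case False
      then have "s \<le> \<bar>real j - y\<bar>" using J[of j] by force
      then have "s\<^sup>2 \<le> (real j - y)\<^sup>2" using \<open>0 < s\<close> by (simp add: abs_le_square_iff[symmetric])
      then have "1 * ?p j \<le> (real j - y)\<^sup>2 / s\<^sup>2 * ?p j"
        using p0 \<open>0 < s\<close> by (intro mult_right_mono) auto
      then show ?thesis using False by (simp add: mult.commute)
    qed
  qed
  ultimately show ?thesis by (metis (no_types, lifting) sums_le)
qed

text \<open>The factor behind \<open>n\<close> is the Poisson weight of \<open>j\<close> for the mean \<open>n x\<close>.\<close>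

lemma gamma_kernel_integer_shape:
  assumes "0 < x" "0 < n"
  shows "gamma_kernel x (real (Suc j)) (1 / n) = n * ((n * x) ^ j / fact j * exp (- (n * x)))"
proof -
  have "Gamma (real (Suc j)) = fact j" using Gamma_fact[of j, where 'a = real] by (simp add: add.commute)
  moreover have "(1 / n) powr real (Suc j) = 1 / (n * n ^ j)"
    using assms by (subst powr_realpow) (auto simp: power_divide)
  moreover have "x powr (real (Suc j) - 1) = x ^ j"
    using assms by (simp add: powr_realpow)
  ultimately show ?thesis
    using assms by (simp add: gamma_kernel_def power_mult_distrib mult_ac del: of_nat_Suc)
qed

text \<open>For \<open>x \<in> [a, b]\<close> the kernel values at \<open>(j + 1, 1 / n)\<close> are \<open>n\<close> times Poisson weights that concentrate on
  the \<open>j\<close> with \<open>j / n\<close> close to \<open>x\<close>, and for these \<open>j\<close> the average of \<open>f\<close> over the \<open>j\<close>-th cell is close to \<open>f x\<close>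
  by uniform continuity. Since \<open>f\<close> is bounded away from 0 on \<open>[a, b]\<close>, the small additive error can be
  absorbed into a factor \<open>\<kappa>\<close>.\<close>

lemma szasz_kantorovich_lower_bound:
  fixes f :: "real \<Rightarrow> real"
  assumes cont: "continuous_on {0..} f" and pos: "\<And>x. 0 < x \<Longrightarrow> 0 < f x"
    and nonneg: "\<And>x. 0 \<le> x \<Longrightarrow> 0 \<le> f x" and bound: "\<And>x. 0 < x \<Longrightarrow> f x \<le> M"
    and int: "set_integrable lborel {0..} f"
    and ab: "0 < a" "a \<le> b" and \<kappa>: "0 < \<kappa>" "\<kappa> < 1"
  shows "\<exists>n N. 0 < n \<and> (\<forall>x\<in>{a..b}. \<kappa> * f x \<le>
    (\<Sum>j<N. (LINT t:{real j / real n..<real (Suc j) / real n}|lborel. f t)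
       * gamma_kernel x (real (Suc j)) (1 / real n)))"
proof -
  have "continuous_on {a..b} f" using cont ab by (auto intro: continuous_on_subset)
  then obtain x0 where x0: "x0 \<in> {a..b}" "\<And>x. x \<in> {a..b} \<Longrightarrow> f x0 \<le> f x"
    using continuous_attains_inf[of "{a..b}" f] ab by auto
  \<comment> \<open>Half of the available gap \<open>(1 - \<kappa>) f x0\<close> is spent on the oscillation of \<open>f\<close>, the other half on the
    Poisson mass far from \<open>x\<close>.\<close>
  define \<delta> where "\<delta> = (1 - \<kappa>) * f x0 / 2"
  have f0: "0 < f x0" using x0 ab pos by auto
  have \<delta>: "0 < \<delta>" "2 * \<delta> \<le> (1 - \<kappa>) * f x" "\<delta> < f x" if "x \<in> {a..b}" for x
  proof -
    show "0 < \<delta>" using f0 \<kappa> by (simp add: \<delta>_def)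
    show 1: "2 * \<delta> \<le> (1 - \<kappa>) * f x" unfolding \<delta>_def using \<kappa> x0(2)[OF that] by simp
    have "(1 - \<kappa>) * f x < 1 * f x" using \<kappa> pos that ab by (intro mult_strict_right_mono) auto
    then show "\<delta> < f x" using 1 \<open>0 < \<delta>\<close> by linarith
  qed
  have "uniformly_continuous_on {0..b + 1} f"
    using cont ab by (intro compact_uniformly_continuous) (auto intro: continuous_on_subset)
  then obtain \<rho>' where \<rho>': "0 < \<rho>'" "\<And>x t. x \<in> {0..b+1} \<Longrightarrow> t \<in> {0..b+1} \<Longrightarrow> dist t x < \<rho>' \<Longrightarrow> dist (f t) (f x) < \<delta>"
    using \<delta>(1)[OF x0(1)] by (rule uniformly_continuous_onE) blast
  define \<rho> where "\<rho> = min \<rho>' 1"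
  have \<rho>: "0 < \<rho>" "\<rho> \<le> 1" "\<rho> \<le> \<rho>'" using \<rho>' by (auto simp: \<rho>_def)
  have M: "0 < M" using f0 bound[of x0] x0 ab by auto
  obtain n where n: "real n > max (2 / \<rho>) (4 * b * M / (\<rho>\<^sup>2 * \<delta>))"
    using reals_Archimedean2 by blast
  have n0: "0 < real n" using n \<rho> by (smt (verit) zero_less_divide_iff)
  have n1: "1 / n < \<rho> / 2" using n n0 \<rho> by (simp add: field_simps)
  have n2: "4 * b / (n * \<rho>\<^sup>2) * M \<le> \<delta>"
    using n n0 \<rho> \<delta>(1)[OF x0(1)] by (simp add: field_simps)
  \<comment> \<open>Every cell that starts before \<open>b + 1\<close> has an index below \<open>N\<close>.\<close>
  define N where "N = nat \<lceil>n * (b + 1)\<rceil>"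
  let ?I = "\<lambda>j. {real j / real n..<real (Suc j) / real n}"
  let ?w = "\<lambda>j. LINT t:?I j|lborel. f t"
  let ?K = "\<lambda>x j. gamma_kernel x (real (Suc j)) (1 / real n)"
  have I0: "?I j \<subseteq> {0..}" for j
  proof
    fix t assume "t \<in> ?I j"
    then have "real j / real n \<le> t" by simp
    moreover have "0 \<le> real j / real n" by simp
    ultimately show "t \<in> {0..}" unfolding atLeast_iff by (rule order_trans[rotated])
  qed
  have intI: "set_integrable lborel (?I j) f" for j
    by (rule set_integrable_subset[OF int _ I0]) simp
  have "\<kappa> * f x \<le> (\<Sum>j<N. ?w j * ?K x j)" if x: "x \<in> {a..b}" for x
  proof -
    define J where "J = {j. j < N \<and> \<bar>real j / n - x\<bar> < \<rho> / 2}"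
    let ?p = "\<lambda>j. (n * x) ^ j / fact j * exp (- (n * x))"
    have K: "?K x j = n * ?p j" for j
      using x ab n0 by (intro gamma_kernel_integer_shape) auto
    have p0: "0 \<le> ?p j" for j using x ab by simp
    have K0: "0 \<le> ?K x j" for j unfolding K by (intro mult_nonneg_nonneg p0) simp
    have w0: "0 \<le> ?w j" for j
    proof -
      have "0 \<le> f t" if "t \<in> ?I j" for t
        using nonneg[of t] subsetD[OF I0 that] by simp
      then show ?thesis
        unfolding set_lebesgue_integral_def
        by (intro Bochner_Integration.integral_nonneg) (simp split: split_indicator)
    qed
    have wJ: "(f x - \<delta>) / n \<le> ?w j" if "j \<in> J" for j
    proof -
      have "f x - \<delta> \<le> f t" if t: "t \<in> ?I j" for t
      proof -
        have "\<bar>t - real j / n\<bar> < \<rho> / 2" using t n1 by (auto simp: add_divide_distrib)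
        moreover have "\<bar>real j / n - x\<bar> < \<rho> / 2" using \<open>j \<in> J\<close> by (simp add: J_def)
        ultimately have d: "\<bar>t - x\<bar> < \<rho>" by linarith
        have "0 \<le> t" using t I0 by blast
        then have "dist (f t) (f x) < \<delta>" using d x ab \<rho> by (intro \<rho>') (auto simp: dist_real_def)
        then show ?thesis by (auto simp: dist_real_def)
      qed
      then have "(LINT t:?I j|lborel. (f x - \<delta>)) \<le> ?w j"
        by (intro set_integral_mono intI) (simp_all add: set_integrable_def divide_right_mono)
      moreover have "(LINT t:?I j|lborel. (f x - \<delta>)) = (f x - \<delta>) / n"
        using n0 by (simp add: set_lebesgue_integral_def) (simp add: field_simps)
      ultimately show ?thesis by simp
    qed
    have "1 - (n * x) / (n * \<rho> / 2)\<^sup>2 \<le> (\<Sum>j\<in>J. ?p j)"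
    proof (rule poisson_chebyshev)
      show "finite J" by (simp add: J_def)
      fix j assume j: "\<bar>real j - n * x\<bar> < n * \<rho> / 2"
      have "real j / n - x = (real j - n * x) / n" using n0 by (simp add: field_simps)
      then have "\<bar>real j / n - x\<bar> < \<rho> / 2" using j n0 by (simp add: field_simps)
      moreover have "real j < n * (b + 1)"
      proof -
        have "real j < n * x + n * \<rho> / 2" using j unfolding abs_less_iff by linarith
        also have "\<dots> = n * (x + \<rho> / 2)" by (simp add: algebra_simps)
        also have "\<dots> \<le> n * (b + 1)" using x \<rho> n0 by (intro mult_left_mono) auto
        finally show ?thesis .
      qed
      then have "j < N" unfolding N_def by linarith
      ultimately show "j \<in> J" by (simp add: J_def)
    qed (use x ab n0 \<rho> in auto)
    also have "(n * x) / (n * \<rho> / 2)\<^sup>2 = 4 * x / (n * \<rho>\<^sup>2)"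
      using n0 \<rho> by (simp add: power2_eq_square field_simps)
    finally have cheb: "1 - 4 * x / (n * \<rho>\<^sup>2) \<le> (\<Sum>j\<in>J. ?p j)" .
    have "4 * x / (n * \<rho>\<^sup>2) * (f x - \<delta>) \<le> 4 * b / (n * \<rho>\<^sup>2) * M"
      using x ab n0 \<rho> \<delta>[OF x] bound[of x]
      by (intro mult_mono divide_right_mono) auto
    then have "\<kappa> * f x \<le> (f x - \<delta>) * (1 - 4 * x / (n * \<rho>\<^sup>2))"
      using n2 \<delta>[OF x] by (simp add: algebra_simps)
    also have "\<dots> \<le> (f x - \<delta>) * (\<Sum>j\<in>J. ?p j)"
      using \<delta>[OF x] by (intro mult_left_mono cheb) auto
    also have "\<dots> = (\<Sum>j\<in>J. (f x - \<delta>) / n * ?K x j)"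
      unfolding K using n0 by (simp add: sum_distrib_left)
    also have "\<dots> \<le> (\<Sum>j\<in>J. ?w j * ?K x j)"
      by (intro sum_mono mult_right_mono wJ K0)
    also have "\<dots> \<le> (\<Sum>j<N. ?w j * ?K x j)"
      by (intro sum_mono2 mult_nonneg_nonneg w0 K0) (auto simp: J_def)
    finally show ?thesis .
  qed
  then show ?thesis using n0 by (intro exI[of _ n] exI[of _ N]) auto
qed

section \<open>Measurability of mixtures\<close>

text \<open>The mixture as a nonnegative extended integral, set to 0 off the positive half-line. In contrast
  to the real-valued mixture it is accessible to Tonelli's theorem and to the measurability
  results for the Giry monad.\<close>

definition nn_gamma_mixture :: "(real \<times> real) measure \<Rightarrow> real \<Rightarrow> ennreal" where
  "nn_gamma_mixture P x = (\<integral>\<^sup>+y. ennreal (gamma_kernel x (fst y) (snd y)) * indicator {0<..} x \<partial>P)"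

text \<open>The kernel is continuous on an open set, so its extension by 0 is Borel measurable.\<close>

lemma measurable_gamma_kernel:
  "(\<lambda>(x, y). ennreal (gamma_kernel x (fst y) (snd y)) * indicator {0<..} x)
     \<in> borel_measurable (borel \<Otimes>\<^sub>M restrict_space borel quadrant)"
proof -
  let ?S = "{0<..} \<times> quadrant :: (real \<times> real \<times> real) set"
  let ?G = "\<lambda>u. indicator ?S u *\<^sub>R (case u of (x, \<alpha>, \<beta>) \<Rightarrow> gamma_kernel x \<alpha> \<beta>)"
  have "open ?S" by (intro open_Times open_greaterThan)
  then have "?G \<in> borel_measurable borel"
    by (intro borel_measurable_continuous_on_indicator continuous_on_gamma_kernel) auto
  moreover have "(\<lambda>u. (fst u, snd u)) \<in> borel \<Otimes>\<^sub>M restrict_space borel quadrant \<rightarrow>\<^sub>M (borel :: (real \<times> real \<times> real) measure)"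
    unfolding borel_prod[symmetric, where 'a = real and 'b = "real \<times> real"]
    by (intro measurable_Pair measurable_fst measurable_compose[OF measurable_snd]
        measurable_restrict_space1 measurable_ident_sets refl)
  then have "(\<lambda>u. u) \<in> borel \<Otimes>\<^sub>M restrict_space borel quadrant \<rightarrow>\<^sub>M (borel :: (real \<times> real \<times> real) measure)"
    by simp
  ultimately have "(\<lambda>u. ennreal (?G u)) \<in> borel_measurable (borel \<Otimes>\<^sub>M restrict_space borel quadrant)"
    by (intro measurable_compose[OF _ measurable_ennreal]) (rule measurable_compose[rotated])
  then show ?thesis
    by (rule measurable_cong[THEN iffD1, rotated])
       (auto simp: space_pair_measure space_restrict_space indicator_def)
qed

lemma measurable_nn_gamma_mixture:
  "(\<lambda>(P, x). nn_gamma_mixture P x)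
     \<in> borel_measurable (prob_measures_algebra quadrant \<Otimes>\<^sub>M borel)"
proof -
  let ?A = "restrict_space borel quadrant :: (real \<times> real) measure"
  have "(\<lambda>(u, y). ennreal (gamma_kernel (snd u) (fst y) (snd y)) * indicator {0<..} (snd u))
      \<in> borel_measurable ((prob_algebra ?A \<Otimes>\<^sub>M borel) \<Otimes>\<^sub>M ?A)"
    using measurable_compose[OF _ measurable_gamma_kernel,
      of "\<lambda>v. (snd (fst v), snd v)" "(prob_algebra ?A \<Otimes>\<^sub>M borel) \<Otimes>\<^sub>M ?A"]
    by (simp add: split_beta)
  then have "(\<lambda>u. \<integral>\<^sup>+y. ennreal (gamma_kernel (snd u) (fst y) (snd y)) * indicator {0<..} (snd u) \<partial>fst u)
      \<in> borel_measurable (prob_algebra ?A \<Otimes>\<^sub>M borel)"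
    by (rule nn_integral_measurable_subprob_algebra2) (intro measurable_prob_algebraD measurable_fst)
  then show ?thesis
    by (simp add: nn_gamma_mixture_def prob_measures_algebra_def split_beta)
qed

context
  fixes P :: "(real \<times> real) measure"
  assumes P: "P \<in> space (prob_measures_algebra quadrant)"
begin

lemma quadrant_prob_space: "prob_space P"
  and sets_quadrant_measure: "sets P = sets (restrict_space borel quadrant)"
  and space_quadrant_measure: "space P = quadrant"
proof -
  show "prob_space P" and s: "sets P = sets (restrict_space borel quadrant)"
    using P by (auto simp: prob_measures_algebra_def space_prob_algebra)
  show "space P = quadrant"
    using sets_eq_imp_space_eq[OF s] by (simp add: space_restrict_space)
qed

lemma borel_measurable_gamma_kernel_section:
  assumes "0 < x" shows "(\<lambda>y. gamma_kernel x (fst y) (snd y)) \<in> borel_measurable P"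
proof -
  have "(\<lambda>y. gamma_kernel x (fst y) (snd y)) \<in> borel_measurable (restrict_space borel quadrant)"
    by (intro borel_measurable_continuous_on_restrict
        continuous_on_compose2[OF continuous_on_gamma_kernel, of _ "\<lambda>y. (x, y)", unfolded split_beta fst_conv snd_conv])
       (auto intro!: continuous_intros assms)
  then show ?thesis using sets_quadrant_measure by (simp cong: measurable_cong_sets)
qed

lemma gamma_mixture_eq_enn2real:
  assumes "0 < x" shows "gamma_mixture P x = enn2real (nn_gamma_mixture P x)"
proof -
  have "gamma_mixture P x = enn2real (\<integral>\<^sup>+y. ennreal (gamma_kernel x (fst y) (snd y)) \<partial>P)"
    unfolding gamma_mixture_def split_beta
    using borel_measurable_gamma_kernel_section[OF assms]
    by (intro integral_eq_nn_integral) (auto simp: space_quadrant_measure intro!: gamma_kernel_nonneg)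
  then show ?thesis using assms by (simp add: nn_gamma_mixture_def)
qed

text \<open>By Tonelli, since every kernel has total mass 1.\<close>

lemma nn_integral_nn_gamma_mixture: "(\<integral>\<^sup>+x. nn_gamma_mixture P x \<partial>lborel) = 1"
proof -
  interpret prob_space P by (rule quadrant_prob_space)
  interpret pair_sigma_finite lborel P by unfold_locales
  have m: "(\<lambda>(x, y). ennreal (gamma_kernel x (fst y) (snd y)) * indicator {0<..} x)
     \<in> borel_measurable (lborel \<Otimes>\<^sub>M P)"
    using measurable_gamma_kernel sets_quadrant_measure
    by (simp cong: measurable_cong_sets sets_pair_measure_cong)
  have "(\<integral>\<^sup>+x. nn_gamma_mixture P x \<partial>lborel)
      = (\<integral>\<^sup>+y. \<integral>\<^sup>+x. ennreal (gamma_kernel x (fst y) (snd y)) * indicator {0<..} x \<partial>lborel \<partial>P)"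
    unfolding nn_gamma_mixture_def using Fubini'[OF m] by simp
  also have "\<dots> = (\<integral>\<^sup>+y. 1 \<partial>P)"
    by (intro nn_integral_cong nn_integral_gamma_kernel) (auto simp: space_quadrant_measure)
  finally show ?thesis by (simp add: emeasure_space_1)
qed

lemma measurable_nn_gamma_mixture_section: "nn_gamma_mixture P \<in> borel_measurable borel"
  using measurable_Pair2[OF measurable_nn_gamma_mixture P] by simp

lemma AE_nn_gamma_mixture_finite: "AE x in lborel. nn_gamma_mixture P x \<noteq> \<infinity>"
  using measurable_nn_gamma_mixture_section nn_integral_nn_gamma_mixture
  by (intro nn_integral_PInf_AE) auto

lemma gamma_mixture_in_densities: "gamma_mixture P \<in> densities_on {0<..}"
proof -
  have "(\<lambda>x. enn2real (nn_gamma_mixture P x)) \<in> borel_measurable (restrict_space borel {0<..})"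
    using measurable_nn_gamma_mixture_section by (intro measurable_restrict_space1) measurable
  then have "gamma_mixture P \<in> borel_measurable (restrict_space borel {0<..})"
    by (rule measurable_cong[THEN iffD1, rotated])
       (simp add: space_restrict_space gamma_mixture_eq_enn2real)
  moreover have "(\<integral>\<^sup>+x\<in>{0<..}. ennreal (gamma_mixture P x) \<partial>lborel) = (\<integral>\<^sup>+x. nn_gamma_mixture P x \<partial>lborel)"
  proof (rule nn_integral_cong_AE, use AE_nn_gamma_mixture_finite in eventually_elim)
    fix x assume "nn_gamma_mixture P x \<noteq> \<infinity>"
    then show "ennreal (gamma_mixture P x) * indicator {0<..} x = nn_gamma_mixture P x"
      by (cases "0 < x") (auto simp: gamma_mixture_eq_enn2real nn_gamma_mixture_def[of P x] less_top)
  qed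
  ultimately show ?thesis
    by (simp add: densities_on_def nn_integral_nn_gamma_mixture gamma_mixture_eq_enn2real)
qed

lemma AE_integrable_gamma_kernel:
  "AE x in lborel. 0 < x \<longrightarrow> integrable P (\<lambda>y. gamma_kernel x (fst y) (snd y))"
  using AE_nn_gamma_mixture_finite
proof eventually_elim
  case (elim x)
  then show ?case
    by (auto intro!: integrableI_nonneg borel_measurable_gamma_kernel_section gamma_kernel_nonneg
        simp: space_quadrant_measure nn_gamma_mixture_def less_top)
qed

end

section \<open>Divergences\<close>

lemma measurable_log_ratio_term [measurable]:
  "(\<lambda>(a, b). log_ratio_term a b) \<in> borel_measurable (borel \<Otimes>\<^sub>M borel)"
  unfolding log_ratio_term_def by measurable

lemma log_ratio_integral_cong:
  assumes "\<And>x. 0 < x \<Longrightarrow> f x = f' x" "\<And>x. 0 < x \<Longrightarrow> g x = g' x"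
  shows "log_ratio_integral f g = log_ratio_integral f' g'"
proof -
  have "(\<integral>\<^sup>+x\<in>{0<..}. h (f x) (g x) \<partial>lborel) = (\<integral>\<^sup>+x\<in>{0<..}. h (f' x) (g' x) \<partial>lborel)"
    for h :: "real \<Rightarrow> real \<Rightarrow> ennreal"
    using assms by (intro nn_integral_cong) (auto split: split_indicator)
  from this[of "\<lambda>a b. e2ennreal (log_ratio_term a b)"] this[of "\<lambda>a b. e2ennreal (- log_ratio_term a b)"]
  show ?thesis unfolding log_ratio_integral_def by simp
qed

text \<open>On the positive half-line the mixture is a jointly measurable function of \<open>(P, x)\<close>; integrating
  over \<open>x\<close> leaves a measurable function of \<open>P\<close>.\<close>

lemma sets_log_ratio_integral_gamma_mixture_less:
  assumes f: "f \<in> borel_measurable (restrict_space borel {0<..})"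
  shows "{P \<in> space (prob_measures_algebra quadrant). log_ratio_integral f (gamma_mixture P) < ereal \<epsilon>}
     \<in> sets (prob_measures_algebra quadrant)"
proof -
  let ?M = "prob_measures_algebra quadrant :: (real \<times> real) measure measure"
  let ?f = "\<lambda>x. indicator {0<..} x *\<^sub>R f x"
  let ?g = "\<lambda>P x. enn2real (nn_gamma_mixture P x)"
  have f': "?f \<in> borel_measurable borel"
    using f by (subst (asm) borel_measurable_restrict_space_iff) auto
  note [measurable] = measurable_nn_gamma_mixture f'
  have "(\<lambda>(P, x). log_ratio_term (?f x) (?g P x)) \<in> borel_measurable (?M \<Otimes>\<^sub>M lborel)"
    by measurable
  then have [measurable]: "(\<lambda>(P, x). log_ratio_term (?f x) (?g P x)) \<in> borel_measurable (?M \<Otimes>\<^sub>M lborel)" .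
  have "(\<lambda>P. log_ratio_integral ?f (?g P)) \<in> borel_measurable ?M"
    unfolding log_ratio_integral_def by measurable
  then have "{P \<in> space ?M. log_ratio_integral ?f (?g P) < ereal \<epsilon>} \<in> sets ?M"
    by measurable
  also have "{P \<in> space ?M. log_ratio_integral ?f (?g P) < ereal \<epsilon>}
      = {P \<in> space ?M. log_ratio_integral f (gamma_mixture P) < ereal \<epsilon>}"
    by (intro Collect_cong conj_cong refl arg_cong2[where f = "(<)"] log_ratio_integral_cong)
       (simp_all add: gamma_mixture_eq_enn2real)
  finally show ?thesis .
qed

text \<open>Every mixture is a density, so the mixture map is measurable into the sigma-algebra that
  defines the induced prior, and the image measure can be evaluated by preimages.\<close>

lemma emeasure_induced_prior:
  assumes \<mu>: "prior_on quadrant \<mu>" and B: "B \<subseteq> densities_on {0<..}"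
    and meas: "{P \<in> space (prob_measures_algebra quadrant). gamma_mixture P \<in> B} \<in> sets (prob_measures_algebra quadrant)"
  shows "emeasure (induced_prior \<mu> (densities_on {0<..}) gamma_mixture) B
    = emeasure \<mu> {P \<in> space (prob_measures_algebra quadrant). gamma_mixture P \<in> B}"
proof -
  let ?D = "densities_on {0<..}"
  let ?\<Sigma> = "{B. B \<subseteq> ?D \<and> gamma_mixture -` B \<inter> space \<mu> \<in> sets \<mu>}"
  have s: "sets \<mu> = sets (prob_measures_algebra quadrant)" using \<mu> by (simp add: prior_on_def)
  then have sp: "space \<mu> = space (prob_measures_algebra quadrant)" by (rule sets_eq_imp_space_eq)
  have "gamma_mixture \<in> \<mu> \<rightarrow>\<^sub>M sigma ?D ?\<Sigma>"
    by (rule measurable_measure_of) (auto simp: sp gamma_mixture_in_densities)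
  moreover have eq: "gamma_mixture -` B \<inter> space \<mu> = {P \<in> space (prob_measures_algebra quadrant). gamma_mixture P \<in> B}"
    by (auto simp: sp)
  then have "B \<in> sets (sigma ?D ?\<Sigma>)"
    using B meas s by auto
  ultimately show ?thesis
    unfolding induced_prior_def eq[symmetric] by (rule emeasure_distr)
qed

lemma small_integral_outside_compact:
  fixes h :: "real \<Rightarrow> real"
  assumes h: "set_integrable lborel {0<..} h" and \<delta>: "0 < \<delta>"
  obtains a b where "0 < a" "a \<le> b" "(LINT x:{0<..} - {a..b}|lborel. h x) < \<delta>"
proof -
  define s :: "nat \<Rightarrow> real \<Rightarrow> real" where "s m = indicator ({0<..} - {1 / real (Suc m)..real (Suc m)})" for m
  have "(\<lambda>m. \<integral>x. s m x *\<^sub>R h x \<partial>lborel) \<longlonglongrightarrow> (\<integral>x. 0 \<partial>(lborel :: real measure))"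
  proof (rule integral_dominated_convergence[where s = "\<lambda>m x. s m x *\<^sub>R h x" and f = "\<lambda>_. 0" and w = "\<lambda>x. \<bar>indicator {0<..} x *\<^sub>R h x\<bar>"])
    show "integrable lborel (\<lambda>x. \<bar>indicator {0<..} x *\<^sub>R h x\<bar>)"
      using h unfolding set_integrable_def by (rule integrable_abs)
    show "(\<lambda>x. s m x *\<^sub>R h x) \<in> borel_measurable lborel" for m
    proof -
      have "set_integrable lborel ({0<..} - {1 / real (Suc m)..real (Suc m)}) h"
        using h by (rule set_integrable_subset) auto
      then show ?thesis unfolding set_integrable_def s_def by (rule borel_measurable_integrable)
    qed
    show "AE x in lborel. norm (s m x *\<^sub>R h x) \<le> \<bar>indicator {0<..} x *\<^sub>R h x\<bar>" for m
      by (auto simp: s_def split: split_indicator)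
    show "AE x in lborel. (\<lambda>m. s m x *\<^sub>R h x) \<longlonglongrightarrow> 0"
    proof (rule AE_I2, rule tendsto_eventually)
      fix x :: real
      obtain k :: nat where k: "max x (1 / x) < k" using reals_Archimedean2 by blast
      have "s m x = 0" if "k \<le> m" for m
      proof (cases "0 < x")
        case True
        have km: "real k < real (Suc m)" using that by simp
        then have "x \<le> real (Suc m)" using k by simp
        moreover have "1 / x \<le> real (Suc m)" using k km by simp
        then have "1 / real (Suc m) \<le> x" using True by (simp add: field_simps)
        ultimately show ?thesis by (simp add: s_def)
      qed (simp add: s_def)
      then show "\<forall>\<^sub>F m in sequentially. s m x *\<^sub>R h x = 0"
        by (intro eventually_sequentiallyI[of k]) simp
    qed
  qed simp
  then have "\<forall>\<^sub>F m in sequentially. (\<integral>x. s m x *\<^sub>R h x \<partial>lborel) < \<delta>"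
    using \<delta> by (intro order_tendstoD) simp_all
  then obtain m where "(\<integral>x. s m x *\<^sub>R h x \<partial>lborel) < \<delta>"
    by (auto simp: eventually_sequentially)
  then show ?thesis
  proof (intro that[of "1 / real (Suc m)" "real (Suc m)"])
    show "1 / real (Suc m) \<le> real (Suc m)" by (rule order_trans[of _ 1]) simp_all
  qed (simp_all add: s_def set_lebesgue_integral_def)
qed

text \<open>The expression \<open>a log (a / b)\<close> decreases in \<open>b\<close>, so replacing \<open>g\<close> by a lower bound increases the
  positive part and decreases the negative part. The lower bound holds almost everywhere
  in the application because a mixture may diverge, and then has the value 0, on a null set.\<close>

lemma log_ratio_integral_le:
  assumes f: "\<And>x. 0 < x \<Longrightarrow> 0 < f x" and L: "\<And>x. 0 < x \<Longrightarrow> 0 < L x"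
    and le: "AE x in lborel. 0 < x \<longrightarrow> L x \<le> g x"
    and int: "set_integrable lborel {0<..} (\<lambda>x. f x * ln (f x / L x))"
  shows "log_ratio_integral f g \<le> ereal (LINT x:{0<..}|lborel. f x * ln (f x / L x))"
proof -
  let ?h = "\<lambda>x. indicator {0<..} x *\<^sub>R (f x * ln (f x / L x))"
  have mono: "AE x in lborel. 0 < x \<longrightarrow> log_ratio_term (f x) (g x) \<le> ereal (?h x)"
    using le
  proof eventually_elim
    case (elim x)
    then show ?case
      using f[of x] L[of x] by (auto simp: log_ratio_term_def intro!: mult_left_mono divide_left_mono)
  qed
  have "(\<integral>\<^sup>+x\<in>{0<..}. e2ennreal (log_ratio_term (f x) (g x)) \<partial>lborel) \<le> (\<integral>\<^sup>+x. ennreal (?h x) \<partial>lborel)"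
  proof (rule nn_integral_mono_AE, use mono in eventually_elim)
    case (elim x)
    then show ?case
      using e2ennreal_mono[of "log_ratio_term (f x) (g x)" "ereal (?h x)"] by (cases "0 < x") simp_all
  qed
  moreover have "(\<integral>\<^sup>+x. ennreal (- ?h x) \<partial>lborel) \<le> (\<integral>\<^sup>+x\<in>{0<..}. e2ennreal (- log_ratio_term (f x) (g x)) \<partial>lborel)"
  proof (rule nn_integral_mono_AE, use mono in eventually_elim)
    case (elim x)
    show ?case
    proof (cases "0 < x")
      case True
      then have "- ereal (?h x) \<le> - log_ratio_term (f x) (g x)"
        using elim by (simp only: ereal_minus_le_minus)
      from e2ennreal_mono[OF this] show ?thesis using True by simp
    qed simp
  qed
  ultimately have "log_ratio_integral f g \<le>
      enn2ereal (\<integral>\<^sup>+x. ennreal (?h x) \<partial>lborel) - enn2ereal (\<integral>\<^sup>+x. ennreal (- ?h x) \<partial>lborel)"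
    unfolding log_ratio_integral_def by (intro ereal_minus_mono) (auto simp: less_eq_ennreal.rep_eq)
  also have "\<dots> = ereal (\<integral>x. ?h x \<partial>lborel)"
  proof -
    have i: "integrable lborel ?h" using int by (simp add: set_integrable_def)
    then obtain r q where "0 \<le> r" "0 \<le> q" "(\<integral>\<^sup>+x. ennreal (?h x) \<partial>lborel) = ennreal r"
      "(\<integral>\<^sup>+x. ennreal (- ?h x) \<partial>lborel) = ennreal q" "(\<integral>x. ?h x \<partial>lborel) = r - q"
      by (rule integrableE)
    then show ?thesis by simp
  qed
  finally show ?thesis by (simp add: set_lebesgue_integral_def)
qed

section \<open>Weak neighbourhoods of discrete mixing measures\<close>

definition tent :: "real \<Rightarrow> 'a::metric_space \<Rightarrow> 'a \<Rightarrow> real" where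
  "tent r c y = max 0 (1 - dist y c / r)"

lemma tent_nonneg [simp]: "0 \<le> tent r c y"
  and tent_le_1 [simp]: "0 < r \<Longrightarrow> tent r c y \<le> 1"
  and tent_center [simp]: "tent r c c = 1"
  and tent_eq_0: "0 < r \<Longrightarrow> r \<le> dist y c \<Longrightarrow> tent r c y = 0"
  by (auto simp: tent_def)

lemma continuous_on_tent: "0 < r \<Longrightarrow> continuous_on A (tent r c)"
  unfolding tent_def by (intro continuous_intros) auto

lemma measurable_tent: "0 < r \<Longrightarrow> tent r c \<in> borel_measurable (restrict_space borel A)"
  by (intro measurable_restrict_space1 borel_measurable_continuous_onI continuous_on_tent)

text \<open>The image of \<open>p\<close> under \<open>z\<close> gives the tent around \<open>z i\<close> an integral of at least \<open>p i\<close>, because the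
  tent is 1 at \<open>z i\<close>. Finitely many strict inequalities between integrals of bounded continuous functions
  cut out a weakly open set.\<close>

lemma weak_neighbourhood_of_discrete_measure:
  fixes z :: "nat \<Rightarrow> 'a::metric_space" and p :: "nat pmf"
  assumes z: "\<And>i. z i \<in> A" and r: "0 < r" and \<kappa>: "\<kappa> < 1"
  shows "\<exists>U P0. openin (weak_topology A) U \<and> P0 \<in> U \<and> U \<subseteq> space (prob_measures_algebra A) \<and>
    (\<forall>P\<in>U. \<forall>i\<le>N. \<kappa> * pmf p i \<le> (\<integral>y. tent r (z i) y \<partial>P))"
proof -
  let ?S = "space (prob_measures_algebra A)"
  \<comment> \<open>For an atom of weight 0 the strict inequality may fail at the discrete measure itself; a negative
    threshold makes it harmless, and the claim is then just nonnegativity of the integral.\<close>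
  define v where "v i = (if pmf p i = 0 then - 1 else \<kappa> * pmf p i)" for i
  define B where "B i = {P \<in> ?S. (\<integral>y. tent r (z i) y \<partial>P) \<in> {v i<..}}" for i
  have "openin (weak_topology A) (B i)" for i
    unfolding weak_topology_def
  proof (rule topology_generated_by_Basis, rule CollectI, intro exI conjI)
    show "B i = {P \<in> ?S. (\<integral>y. tent r (z i) y \<partial>P) \<in> {v i<..}}" by (simp add: B_def)
    show "continuous_on A (tent r (z i))" using r by (rule continuous_on_tent)
    show "bounded (tent r (z i) ` A)" using r by (intro boundedI[of _ 1]) auto
  qed simp
  then have "openin (weak_topology A) (\<Inter>i\<in>{..N}. B i)"
    by (intro openin_INT2) auto
  moreover
  have zm: "z \<in> measure_pmf p \<rightarrow>\<^sub>M restrict_space borel A"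
    using z by (intro measurable_restrict_space2) auto
  define P0 where "P0 = distr (measure_pmf p) (restrict_space borel A) z"
  have "P0 \<in> ?S"
    unfolding P0_def prob_measures_algebra_def space_prob_algebra
    using zm by (auto intro: measure_pmf.prob_space_distr)
  moreover have "v i < (\<integral>y. tent r (z i) y \<partial>P0)" for i
  proof -
    have "(\<integral>y. tent r (z i) y \<partial>P0) = (\<integral>k. tent r (z i) (z k) \<partial>measure_pmf p)"
      unfolding P0_def using measurable_tent[OF r] zm by (rule integral_distr[rotated])
    moreover have "pmf p i \<le> \<dots>"
    proof -
      have "pmf p i = (\<integral>k. indicator {i} k \<partial>measure_pmf p)" by (simp add: measure_pmf_single)
      also have "\<dots> \<le> (\<integral>k. tent r (z i) (z k) \<partial>measure_pmf p)"
        by (rule integral_mono)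
           (use r in \<open>auto split: split_indicator intro!: measure_pmf.integrable_const_bound[where B = 1]\<close>)
      finally show ?thesis .
    qed
    moreover have "v i < pmf p i"
    proof (cases "pmf p i = 0")
      case False
      then have "0 < pmf p i" using pmf_nonneg[of p i] by linarith
      with \<kappa> show ?thesis by (simp add: v_def)
    qed (simp add: v_def)
    ultimately show ?thesis by linarith
  qed
  ultimately have "openin (weak_topology A) (\<Inter>i\<in>{..N}. B i)" "P0 \<in> (\<Inter>i\<in>{..N}. B i)"
    by (auto simp: B_def)
  moreover have "\<kappa> * pmf p i \<le> (\<integral>y. tent r (z i) y \<partial>P)" if "P \<in> B i" for P i
    using that by (cases "pmf p i = 0") (auto simp: B_def v_def)
  moreover have "(\<Inter>i\<in>{..N}. B i) \<subseteq> ?S"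
    by (auto simp: B_def)
  ultimately show ?thesis
    by (intro exI[of _ "\<Inter>i\<in>{..N}. B i"] exI[of _ P0]) auto
qed

text \<open>Tents around points that are at least \<open>2 r\<close> apart are positive on disjoint sets, so at most one term
  of the sum is nonzero.\<close>

lemma sum_separated_tents_le:
  assumes I: "finite I" and r: "0 < r"
    and sep: "\<And>i k. i \<in> I \<Longrightarrow> k \<in> I \<Longrightarrow> i \<noteq> k \<Longrightarrow> 2 * r \<le> dist (z i) (z k)"
    and c: "\<And>i. i \<in> I \<Longrightarrow> 0 \<le> c i" and F: "0 \<le> F"
    and le: "\<And>i. i \<in> I \<Longrightarrow> dist y (z i) < r \<Longrightarrow> c i \<le> F"
  shows "(\<Sum>i\<in>I. c i * tent r (z i) y) \<le> F"
proof (cases "\<exists>i\<in>I. dist y (z i) < r")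
  case True
  then obtain i where i: "i \<in> I" "dist y (z i) < r" by blast
  have "tent r (z k) y = 0" if "k \<in> I - {i}" for k
  proof -
    have "2 * r \<le> dist (z i) (z k)" using that i by (intro sep) auto
    also have "\<dots> \<le> dist y (z i) + dist y (z k)" by (metis dist_commute dist_triangle)
    finally show ?thesis using i r by (intro tent_eq_0) linarith+
  qed
  then have "(\<Sum>k\<in>I. c k * tent r (z k) y) = c i * tent r (z i) y"
    using I i by (subst sum.remove[of I i]) simp_all
  also have "\<dots> \<le> c i" using c[OF i(1)] r by (intro mult_left_le) auto
  also have "\<dots> \<le> F" using le i by blast
  finally show ?thesis .
next
  case False
  then have "(\<Sum>i\<in>I. c i * tent r (z i) y) = 0"
    using r by (intro sum.neutral) (auto intro: tent_eq_0 simp: not_less)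
  then show ?thesis using F by simp
qed

text \<open>Only the mass of \<open>P\<close> near the points \<open>z i\<close> is counted, and on each of these neighbourhoods the kernel is
  replaced by a constant lower bound.\<close>

lemma gamma_mixture_ge_sum_tents:
  assumes P: "P \<in> space (prob_measures_algebra quadrant)" and r: "0 < r" and I: "finite I"
    and x: "0 < x" and int: "integrable P (\<lambda>y. gamma_kernel x (fst y) (snd y))"
    and sep: "\<And>i k. i \<in> I \<Longrightarrow> k \<in> I \<Longrightarrow> i \<noteq> k \<Longrightarrow> 2 * r \<le> dist (z i) (z k)"
    and c: "\<And>i. i \<in> I \<Longrightarrow> 0 \<le> c i"
    and le: "\<And>i y. i \<in> I \<Longrightarrow> dist y (z i) < r \<Longrightarrow> c i \<le> gamma_kernel x (fst y) (snd y)"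
    and W: "\<And>i. i \<in> I \<Longrightarrow> W i \<le> (\<integral>y. tent r (z i) y \<partial>P)"
  shows "(\<Sum>i\<in>I. c i * W i) \<le> gamma_mixture P x"
proof -
  interpret prob_space P using P by (rule quadrant_prob_space)
  have t: "integrable P (tent r (z i))" for i
    using r measurable_tent[OF r] sets_quadrant_measure[OF P]
    by (intro integrable_const_bound[where B = 1]) (auto cong: measurable_cong_sets)
  have "(\<Sum>i\<in>I. c i * W i) \<le> (\<Sum>i\<in>I. c i * (\<integral>y. tent r (z i) y \<partial>P))"
    using c W by (intro sum_mono mult_left_mono) auto
  also have "\<dots> = (\<integral>y. (\<Sum>i\<in>I. c i * tent r (z i) y) \<partial>P)"
    using t by simp
  also have "\<dots> \<le> (\<integral>y. gamma_kernel x (fst y) (snd y) \<partial>P)"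
  proof (rule integral_mono)
    show "(\<Sum>i\<in>I. c i * tent r (z i) y) \<le> gamma_kernel x (fst y) (snd y)" if "y \<in> space P" for y
      using that I r sep c le
      by (intro sum_separated_tents_le) (auto simp: space_quadrant_measure[OF P] intro!: gamma_kernel_nonneg)
  qed (use t int in auto)
  also have "\<dots> = gamma_mixture P x" unfolding gamma_mixture_def split_beta ..
  finally show ?thesis .
qed

text \<open>The four factors \<open>\<kappa>\<close> on \<open>[a, b]\<close> are the losses of four steps: the approximation of \<open>f\<close>, the mass
  reserved for the atom at \<open>(1 / 2, 2)\<close>, the mass near each atom when passing to \<open>P\<close>, and the
  variation of the kernel near each atom.\<close>

lemma weak_neighbourhood_with_large_mixtures:
  fixes f :: "real \<Rightarrow> real"
  assumes cont: "continuous_on {0..} f" and pos: "\<And>x. 0 < x \<Longrightarrow> 0 < f x"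
    and nonneg: "\<And>x. 0 \<le> x \<Longrightarrow> 0 \<le> f x" and bound: "\<And>x. 0 < x \<Longrightarrow> f x \<le> M"
    and int: "set_integrable lborel {0..} f" "(LINT x:{0..}|lborel. f x) = 1"
    and ab: "0 < a" "a \<le> b" and \<kappa>: "0 < \<kappa>" "\<kappa> < 1" and c: "0 < c"
    and tail: "\<And>x y. 0 < x \<Longrightarrow> dist y (1 / 2, 2) < 1 / 4 \<Longrightarrow> c * exp (- 2 * x) \<le> gamma_kernel x (fst y) (snd y)"
  shows "\<exists>U P0. openin (weak_topology quadrant) U \<and> P0 \<in> U \<and> U \<subseteq> space (prob_measures_algebra quadrant) \<and>
    (\<forall>P\<in>U. AE x in lborel. 0 < x \<longrightarrow>
      (if x \<in> {a..b} then \<kappa> ^ 4 * f x else \<kappa> * (1 - \<kappa>) * c * exp (- 2 * x)) \<le> gamma_mixture P x)"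
proof -
  define w where "w n j = (LINT t:{real j / real n..<real (Suc j) / real n}|lborel. f t)" for n j :: nat
  obtain n N :: nat where n: "0 < n" and approx: "\<And>x. x \<in> {a..b} \<Longrightarrow> \<kappa> * f x \<le>
      (\<Sum>j<N. w n j * gamma_kernel x (real (Suc j)) (1 / real n))"
    using szasz_kantorovich_lower_bound[OF cont pos nonneg bound int(1) ab \<kappa>] unfolding w_def by blast
  let ?I = "\<lambda>j. {real j / real n..<real (Suc j) / real n}"
  have I0: "?I j \<subseteq> {0..}" for j
    by (meson Icc_subset_Ici_iff atLeastLessThan_subseteq_atLeastAtMost_iff divide_nonneg_nonneg of_nat_0_le_iff
      atLeastLessThan_iff atLeast_iff order_trans subsetI)
  have w0: "0 \<le> w n j" for j
    unfolding w_def set_lebesgue_integral_def using subsetD[OF I0] nonneg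
    by (intro Bochner_Integration.integral_nonneg) (simp split: split_indicator)
  have w1: "(\<Sum>j<N. w n j) \<le> 1"
  proof -
    have intI: "set_integrable lborel (?I j) f" for j
      by (rule set_integrable_subset[OF int(1) _ I0]) simp
    have "(\<Sum>j<N. w n j) = (\<integral>t. (\<Sum>j<N. indicator (?I j) t *\<^sub>R f t) \<partial>lborel)"
      unfolding w_def set_lebesgue_integral_def
      using intI unfolding set_integrable_def by (subst Bochner_Integration.integral_sum) auto
    also have "\<dots> \<le> (LINT x:{0..}|lborel. f x)"
      unfolding set_lebesgue_integral_def
    proof (rule integral_mono)
      show "integrable lborel (\<lambda>t. \<Sum>j<N. indicator (?I j) t *\<^sub>R f t)"
        using intI unfolding set_integrable_def by (intro Bochner_Integration.integrable_sum)
      show "integrable lborel (\<lambda>x. indicator {0..} x *\<^sub>R f x)"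
        using int(1) unfolding set_integrable_def .
      show "(\<Sum>j<N. indicator (?I j) t *\<^sub>R f t) \<le> indicator {0..} t *\<^sub>R f t" for t
      proof (cases "\<exists>j<N. t \<in> ?I j")
        case True
        then obtain j where j: "j < N" "t \<in> ?I j" by blast
        have uniq: "k = j" if "t \<in> ?I k" for k
        proof -
          have "real k \<le> t * n" "t * n < real (Suc k)" "real j \<le> t * n" "t * n < real (Suc j)"
            using that j n by (simp_all add: field_simps)
          then show "k = j" by linarith
        qed
        then have "(\<Sum>k<N. indicator (?I k) t *\<^sub>R f t) = (\<Sum>k<N. if k = j then f t else 0)"
        proof (intro sum.cong refl)
          fix k
          show "indicator (?I k) t *\<^sub>R f t = (if k = j then f t else 0)"
          proof (cases "k = j")
            case True
            then show ?thesis using j(2) by (simp only: indicator_simps(1) scaleR_one simp_thms if_True)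
          next
            case False
            then have "t \<notin> ?I k" using uniq by blast
            then show ?thesis using False by (simp only: indicator_simps(2) scaleR_zero_left simp_thms if_False)
          qed
        qed
        also have "\<dots> = f t" using j by simp
        also have "\<dots> = indicator {0..} t *\<^sub>R f t" using subsetD[OF I0 j(2)] by simp
        finally show ?thesis by (rule eq_refl)
      next
        case False
        then have "(\<Sum>j<N. indicator (?I j) t *\<^sub>R f t) = 0" by (intro sum.neutral) (simp split: split_indicator)
        also have "0 \<le> indicator {0..} t *\<^sub>R f t" using nonneg by (simp split: split_indicator)
        finally show ?thesis .
      qed
    qed
    finally show ?thesis using int(2) by simp
  qed
  \<comment> \<open>The atom with index 0 at \<open>(1 / 2, 2)\<close> receives all the mass that the atoms at \<open>(j + 1, 1 / n)\<close> leave,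
    including the mass of \<open>f\<close> beyond \<open>N / n\<close>.\<close>
  define W where "W i = (case i of 0 \<Rightarrow> 1 - \<kappa> * (\<Sum>j<N. w n j) | Suc j \<Rightarrow> if j < N then \<kappa> * w n j else 0)" for i
  have W0: "1 - \<kappa> \<le> W 0" using mult_left_mono[OF w1, of \<kappa>] \<kappa> by (simp add: W_def)
  have WSuc: "W (Suc j) = \<kappa> * w n j" if "j < N" for j using that by (simp add: W_def)
  have W_nonneg: "0 \<le> W i" for i
  proof (cases i)
    case 0
    then show ?thesis using W0 \<kappa> by simp
  qed (use w0 \<kappa> in \<open>simp add: W_def\<close>)
  have W_sum: "(\<Sum>i\<le>N. W i) = 1"
  proof -
    have "(\<Sum>i\<le>N. W i) = W 0 + (\<Sum>j<N. W (Suc j))"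
      unfolding lessThan_Suc_atMost[symmetric] by (rule sum.lessThan_Suc_shift)
    also have "(\<Sum>j<N. W (Suc j)) = \<kappa> * (\<Sum>j<N. w n j)"
      by (simp add: WSuc sum_distrib_left)
    finally show ?thesis by (simp add: W_def)
  qed
  have "(\<integral>\<^sup>+i. ennreal (W i) \<partial>count_space UNIV) = (\<Sum>i\<le>N. ennreal (W i))"
    by (rule nn_integral_count_space') (auto simp: W_def split: nat.split)
  also have "\<dots> = 1" using W_nonneg W_sum by (simp add: sum_ennreal)
  finally have pmf_W: "pmf (embed_pmf W) i = W i" for i
    using W_nonneg by (intro pmf_embed_pmf)

  define z where "z i = (case i of 0 \<Rightarrow> (1 / 2, 2) | Suc j \<Rightarrow> (real (Suc j), 1 / real n))" for i
  have z: "z i \<in> quadrant" for i using n by (cases i) (auto simp: z_def)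
  have sep: "1 / 2 \<le> dist (z i) (z k)" if "i \<noteq> k" for i k
  proof -
    have fst_z: "fst (z i) = (if i = 0 then 1 / 2 else real i)" for i
      by (cases i) (simp_all add: z_def)
    have "1 \<le> \<bar>real i - real k\<bar>"
      using that by (cases i k rule: linorder_cases) auto
    then have "1 / 2 \<le> \<bar>fst (z i) - fst (z k)\<bar>"
      unfolding fst_z by (cases "i = 0"; cases "k = 0") auto
    then show ?thesis using dist_fst_le[of "z i" "z k"] by (simp add: dist_real_def)
  qed
  have "\<forall>\<^sub>F r in at_right 0. \<forall>i\<in>{..N}. \<forall>x\<in>{a..b}. \<forall>y. dist y (z i) < r \<longrightarrow>
      \<kappa> * gamma_kernel x (fst (z i)) (snd (z i)) \<le> gamma_kernel x (fst y) (snd y)"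
    using z ab \<kappa> by (intro eventually_ball_finite gamma_kernel_eventually_ge ballI) auto
  moreover have "\<forall>\<^sub>F r in at_right 0. 0 < r \<and> r < (1 / 4 :: real)"
    by (auto simp: eventually_at_right_field intro!: exI[of _ "1 / 4"])
  ultimately obtain r where r: "0 < r" "r < 1 / 4" and
    near: "\<And>i x y. i \<le> N \<Longrightarrow> x \<in> {a..b} \<Longrightarrow> dist y (z i) < r \<Longrightarrow>
      \<kappa> * gamma_kernel x (fst (z i)) (snd (z i)) \<le> gamma_kernel x (fst y) (snd y)"
    using eventually_happens'[OF trivial_limit_at_right_real eventually_conj]
    by (metis (no_types, lifting) atMost_iff)
  have sep_r: "2 * r \<le> dist (z i) (z k)" if "i \<noteq> k" for i k
    using sep[OF that] r by linarith
  obtain U P0 where U: "openin (weak_topology quadrant) U" "P0 \<in> U" "U \<subseteq> space (prob_measures_algebra quadrant)"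
    and "\<forall>P\<in>U. \<forall>i\<le>N. \<kappa> * W i \<le> (\<integral>y. tent r (z i) y \<partial>P)"
    using weak_neighbourhood_of_discrete_measure[where z = z and p = "embed_pmf W" and N = N, OF z r(1) \<kappa>(2)]
    unfolding pmf_W by (elim exE conjE) (rule that)
  then have mass: "\<kappa> * W i \<le> (\<integral>y. tent r (z i) y \<partial>P)" if "P \<in> U" "i \<le> N" for P i
    using that by simp
  have large: "(if x \<in> {a..b} then \<kappa> ^ 4 * f x else \<kappa> * (1 - \<kappa>) * c * exp (- 2 * x)) \<le> gamma_mixture P x"
    if P: "P \<in> U" and x: "0 < x" and intP: "integrable P (\<lambda>y. gamma_kernel x (fst y) (snd y))" for P x
  proof (cases "x \<in> {a..b}")
    case True
    let ?K = "\<lambda>i. gamma_kernel x (fst (z i)) (snd (z i))"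
    have K0: "0 \<le> ?K i" for i using z[of i] by (intro gamma_kernel_nonneg) auto
    have "\<kappa> ^ 4 * f x = \<kappa> ^ 3 * (\<kappa> * f x)" by (simp add: eval_nat_numeral)
    also have "\<dots> \<le> \<kappa> ^ 3 * (\<Sum>j<N. w n j * gamma_kernel x (real (Suc j)) (1 / real n))"
      using approx[OF True] \<kappa> by (intro mult_left_mono) auto
    also have "\<dots> = (\<Sum>j<N. (\<kappa> * ?K (Suc j)) * (\<kappa> * W (Suc j)))"
      by (simp add: sum_distrib_left WSuc z_def eval_nat_numeral mult_ac)
    also have "\<dots> \<le> (\<Sum>i\<le>N. (\<kappa> * ?K i) * (\<kappa> * W i))"
      unfolding lessThan_Suc_atMost[symmetric] sum.lessThan_Suc_shift
      using \<kappa> K0[of 0] W_nonneg[of 0] by simp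
    also have "\<dots> \<le> gamma_mixture P x"
      by (rule gamma_mixture_ge_sum_tents[where r = r and z = z])
         (use P U x intP r sep_r \<kappa> K0 near[OF _ True] mass in auto)
    finally show ?thesis unfolding if_P[OF True] .
  next
    case False
    have "\<kappa> * (1 - \<kappa>) * c * exp (- 2 * x) = (c * exp (- 2 * x)) * (\<kappa> * (1 - \<kappa>))" by simp
    also have "\<dots> \<le> (\<Sum>i\<in>{0}. (c * exp (- 2 * x)) * (\<kappa> * W i))"
      using W0 \<kappa> c by (auto intro!: mult_left_mono)
    also have "\<dots> \<le> gamma_mixture P x"
    proof (rule gamma_mixture_ge_sum_tents[where r = r and z = z])
      show "c * exp (- 2 * x) \<le> gamma_kernel x (fst y) (snd y)" if "i \<in> {0}" "dist y (z i) < r" for i y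
        using that r x by (intro tail) (auto simp: z_def)
    qed (use P U x intP r c mass in auto)
    finally show ?thesis unfolding if_not_P[OF False] .
  qed
  have "\<forall>P\<in>U. AE x in lborel. 0 < x \<longrightarrow>
      (if x \<in> {a..b} then \<kappa> ^ 4 * f x else \<kappa> * (1 - \<kappa>) * c * exp (- 2 * x)) \<le> gamma_mixture P x"
  proof
    fix P assume P: "P \<in> U"
    with U(3) have "P \<in> space (prob_measures_algebra quadrant)" by blast
    from AE_integrable_gamma_kernel[OF this]
    show "AE x in lborel. 0 < x \<longrightarrow>
      (if x \<in> {a..b} then \<kappa> ^ 4 * f x else \<kappa> * (1 - \<kappa>) * c * exp (- 2 * x)) \<le> gamma_mixture P x"
    proof eventually_elim
      case (elim x)
      then show ?case using large[OF P] by (intro impI) (elim impE)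
    qed
  qed
  then show ?thesis using U by blast
qed

section \<open>The Kullback-Leibler property\<close>

theorem theorem14:
  fixes \<mu> :: "(real \<times> real) measure measure" and f0 :: "real \<Rightarrow> real"
  assumes prior: "prior_on ({0<..} \<times> {0<..}) \<mu>"
    and full_support: "weak_support ({0<..} \<times> {0<..}) \<mu> =
      space (prob_measures_algebra ({0<..} \<times> {0<..}))"
    and density: "f0 \<in> densities_on {0..}"
    and cont: "continuous_on {0..} f0"
    and bdd: "bounded (f0 ` {0..})"
    and B4: "\<exists>M>0. \<forall>x>0. 0 < f0 x \<and> f0 x \<le> M"
    and B5: "set_integrable lborel {0<..} (\<lambda>x. f0 x * ln (f0 x))"
    and B6: "\<exists>\<delta>>0. log_ratio_integral f0 (local_inf f0 \<delta>) < \<infinity>"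
    and B7: "\<exists>\<eta>>0. (\<integral>\<^sup>+x\<in>{0<..}. ennreal (max (x powr (-\<eta> - 2)) (x powr (\<eta> + 2)) * f0 x) \<partial>lborel) < \<infinity>"
  shows "f0 \<in> KL_support (induced_prior \<mu> (densities_on {0<..}) gamma_mixture)"
proof -
  let ?D = "densities_on {0<..}"
  obtain M where M: "\<And>x. 0 < x \<Longrightarrow> 0 < f0 x" "\<And>x. 0 < x \<Longrightarrow> f0 x \<le> M" using B4 by blast
  have nonneg: "0 \<le> f0 x" if "0 \<le> x" for x using density that by (simp add: densities_on_def)
  have "has_bochner_integral lborel (\<lambda>x. indicator {0..} x *\<^sub>R f0 x) 1"
  proof (rule has_bochner_integral_nn_integral)
    show "(\<lambda>x. indicator {0..} x *\<^sub>R f0 x) \<in> borel_measurable lborel"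
      using borel_measurable_continuous_on_indicator[OF _ cont] by simp
    have "(\<integral>\<^sup>+x. ennreal (indicator {0..} x *\<^sub>R f0 x) \<partial>lborel) = (\<integral>\<^sup>+x\<in>{0..}. ennreal (f0 x) \<partial>lborel)"
      by (intro nn_integral_cong) (simp split: split_indicator)
    then show "(\<integral>\<^sup>+x. ennreal (indicator {0..} x *\<^sub>R f0 x) \<partial>lborel) = ennreal 1"
      using density by (simp add: densities_on_def)
  qed (use nonneg in \<open>auto split: split_indicator\<close>)
  then have int: "set_integrable lborel {0..} f0" and int1: "(LINT x:{0..}|lborel. f0 x) = 1"
    by (auto simp: set_integrable_def set_lebesgue_integral_def has_bochner_integral_iff)
  have int0: "set_integrable lborel {0<..} f0" by (rule set_integrable_subset[OF int]) auto
  have cont0: "continuous_on {0<..} f0" using cont by (rule continuous_on_subset) auto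
  have intx: "set_integrable lborel {0<..} (\<lambda>x. x * f0 x)"
  proof -
    obtain \<eta> where \<eta>: "0 < \<eta>"
      "(\<integral>\<^sup>+x\<in>{0<..}. ennreal (max (x powr (-\<eta> - 2)) (x powr (\<eta> + 2)) * f0 x) \<partial>lborel) < \<infinity>"
      using B7 by blast
    have le: "x \<le> max (x powr (-\<eta> - 2)) (x powr (\<eta> + 2))" if "0 < x" for x
    proof (cases "x \<le> 1")
      case True
      then have "1 powr (-\<eta> - 2) \<le> x powr (-\<eta> - 2)" using that \<eta> by (intro powr_mono2') auto
      then show ?thesis using True by simp
    next
      case False
      then have "x powr 1 \<le> x powr (\<eta> + 2)" using \<eta> by (intro powr_mono) auto
      then show ?thesis using that by simp
    qed
    show ?thesis unfolding set_integrable_def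
    proof (rule integrableI_bounded)
      show "(\<lambda>x. indicator {0<..} x *\<^sub>R (x * f0 x)) \<in> borel_measurable lborel"
        using borel_measurable_continuous_on_indicator[of "{0<..}" "\<lambda>x. x * f0 x"]
        by (simp add: continuous_intros cont0)
      have "(\<integral>\<^sup>+x. ennreal (norm (indicator {0<..} x *\<^sub>R (x * f0 x))) \<partial>lborel)
          \<le> (\<integral>\<^sup>+x\<in>{0<..}. ennreal (max (x powr (-\<eta> - 2)) (x powr (\<eta> + 2)) * f0 x) \<partial>lborel)"
        using M(1) le
        by (intro nn_integral_mono) (auto simp: abs_mult less_imp_le intro!: ennreal_leI mult_right_mono split: split_indicator)
      then show "(\<integral>\<^sup>+x. ennreal (norm (indicator {0<..} x *\<^sub>R (x * f0 x))) \<partial>lborel) < \<infinity>"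
        using \<eta>(2) by (rule le_less_trans)
    qed
  qed
  obtain c where c: "0 < c"
    "\<And>x y. 0 < x \<Longrightarrow> dist y (1 / 2, 2) < 1 / 4 \<Longrightarrow> c * exp (- 2 * x) \<le> gamma_kernel x (fst y) (snd y)"
    using gamma_kernel_exponential_lower_bound by blast
  have meas: "f0 \<in> borel_measurable (restrict_space borel {0<..})"
    using cont0 by (rule borel_measurable_continuous_on_restrict)
  have "0 < emeasure (induced_prior \<mu> ?D gamma_mixture)
      {f \<in> space (induced_prior \<mu> ?D gamma_mixture). log_ratio_integral f0 f < ereal \<epsilon>}"
    if \<epsilon>: "0 < \<epsilon>" for \<epsilon>
  proof -
    \<comment> \<open>With this choice the factor \<open>\<kappa> ^ 4\<close> contributes exactly \<open>\<epsilon> / 2\<close> to the divergence.\<close>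
    define \<kappa> where "\<kappa> = exp (- \<epsilon> / 8)"
    have \<kappa>: "0 < \<kappa>" "\<kappa> < 1" using \<epsilon> by (simp_all add: \<kappa>_def)
    have \<kappa>4: "\<kappa> ^ 4 = exp (- \<epsilon> / 2)" by (simp add: \<kappa>_def exp_of_nat_mult[symmetric])
    define d where "d = \<kappa> * (1 - \<kappa>) * c"
    have d: "0 < d" using \<kappa> c by (simp add: d_def)
    \<comment> \<open>The integrand \<open>f0 ln (f0 / (d exp (- 2 x)))\<close>, written as a sum of integrable functions.\<close>
    let ?h = "\<lambda>x. f0 x * ln (f0 x) + (2 * (x * f0 x) - ln d * f0 x)"
    have inth: "set_integrable lborel {0<..} ?h"
      using B5 intx int0 by (intro set_integral_add set_integral_diff set_integrable_mult_right) auto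
    obtain a b where ab: "0 < a" "a \<le> b" and small: "(LINT x:{0<..} - {a..b}|lborel. ?h x) < \<epsilon> / 2"
      using small_integral_outside_compact[OF inth, of "\<epsilon> / 2"] \<epsilon> by auto
    let ?L = "\<lambda>x. if x \<in> {a..b} then \<kappa> ^ 4 * f0 x else d * exp (- 2 * x)"
    obtain U P0 where U: "openin (weak_topology quadrant) U" "P0 \<in> U" "U \<subseteq> space (prob_measures_algebra quadrant)"
      and large: "\<forall>P\<in>U. AE x in lborel. 0 < x \<longrightarrow> ?L x \<le> gamma_mixture P x"
    proof -
      have "\<exists>U P0. openin (weak_topology quadrant) U \<and> P0 \<in> U \<and> U \<subseteq> space (prob_measures_algebra quadrant) \<and>
          (\<forall>P\<in>U. AE x in lborel. 0 < x \<longrightarrow> ?L x \<le> gamma_mixture P x)"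
        unfolding d_def
        by (rule weak_neighbourhood_with_large_mixtures[where M = M, OF cont _ _ _ int int1 ab \<kappa> c(1)])
           (use M nonneg c(2) in blast)+
      then show ?thesis using that by blast
    qed
    have L: "0 < ?L x" if "0 < x" for x using M(1)[OF that] \<kappa> d by simp
    have split: "indicator {0<..} x *\<^sub>R (f0 x * ln (f0 x / ?L x)) =
        indicator {a..b} x *\<^sub>R (\<epsilon> / 2 * f0 x) + indicator ({0<..} - {a..b}) x *\<^sub>R ?h x" for x
    proof (cases "0 < x")
      case True
      then have f: "0 < f0 x" by (rule M)
      have 1: "ln (f0 x / (\<kappa> ^ 4 * f0 x)) = \<epsilon> / 2"
        unfolding \<kappa>4 using f by (simp add: ln_div)
      have 2: "ln (f0 x / (d * exp (- 2 * x))) = ln (f0 x) + 2 * x - ln d"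
        using f d by (simp add: ln_div ln_mult)
      show ?thesis unfolding if_distrib[of "\<lambda>t. ln (f0 x / t)"] 1 2
        using True by (simp add: algebra_simps)
    qed (use ab in auto)
    have i1: "integrable lborel (\<lambda>x. indicator {a..b} x *\<^sub>R (\<epsilon> / 2 * f0 x))"
      using set_integrable_subset[OF int, of "{a..b}"] ab
      unfolding set_integrable_def[symmetric] by (intro set_integrable_mult_right) auto
    have i2: "integrable lborel (\<lambda>x. indicator ({0<..} - {a..b}) x *\<^sub>R ?h x)"
      using set_integrable_subset[OF inth, of "{0<..} - {a..b}"] unfolding set_integrable_def by auto
    have "(\<integral>x. indicator {a..b} x *\<^sub>R (\<epsilon> / 2 * f0 x) \<partial>lborel) \<le> (\<integral>x. indicator {0..} x *\<^sub>R (\<epsilon> / 2 * f0 x) \<partial>lborel)"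
      using i1 set_integrable_mult_right[OF int, of "\<epsilon> / 2"] ab \<epsilon> nonneg
      by (intro integral_mono) (auto simp: set_integrable_def split: split_indicator)
    also have "\<dots> = \<epsilon> / 2"
      using int1 unfolding set_lebesgue_integral_def[symmetric] by (simp add: set_integral_mult_right)
    finally have less: "(LINT x:{0<..}|lborel. f0 x * ln (f0 x / ?L x)) < \<epsilon>"
      using small unfolding set_lebesgue_integral_def split
      by (subst Bochner_Integration.integral_add[OF i1 i2]) linarith
    have intL: "set_integrable lborel {0<..} (\<lambda>x. f0 x * ln (f0 x / ?L x))"
      unfolding set_integrable_def split using i1 i2 by (rule Bochner_Integration.integrable_add)
    have small_KL: "log_ratio_integral f0 (gamma_mixture P) < ereal \<epsilon>" if "P \<in> U" for P
    proof -
      have "log_ratio_integral f0 (gamma_mixture P) \<le> ereal (LINT x:{0<..}|lborel. f0 x * ln (f0 x / ?L x))"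
        using M(1) L bspec[OF large that] intL by (rule log_ratio_integral_le)
      also have "\<dots> < ereal \<epsilon>" unfolding less_ereal.simps(1) by (rule less)
      finally show ?thesis .
    qed
    let ?V = "{P \<in> space (prob_measures_algebra quadrant). log_ratio_integral f0 (gamma_mixture P) < ereal \<epsilon>}"
    have V: "?V \<in> sets (prob_measures_algebra quadrant)"
      using meas by (rule sets_log_ratio_integral_gamma_mixture_less)
    have "P0 \<in> weak_support quadrant \<mu>" using full_support U by auto
    then have "0 < emeasure \<mu> U" using U by (simp add: weak_support_def)
    also have "\<dots> \<le> emeasure \<mu> ?V"
      using U small_KL V prior by (intro emeasure_mono) (auto simp: prior_on_def)
    also have "\<dots> = emeasure (induced_prior \<mu> ?D gamma_mixture) {f \<in> ?D. log_ratio_integral f0 f < ereal \<epsilon>}"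
    proof -
      have eq: "{P \<in> space (prob_measures_algebra quadrant). gamma_mixture P \<in> {f \<in> ?D. log_ratio_integral f0 f < ereal \<epsilon>}} = ?V"
        by (auto intro: gamma_mixture_in_densities)
      show ?thesis
        using emeasure_induced_prior[OF prior, of "{f \<in> ?D. log_ratio_integral f0 f < ereal \<epsilon>}"] V
        unfolding eq by auto
    qed
    finally show ?thesis by (simp add: induced_prior_def space_measure_of_conv)
  qed
  then show ?thesis by (simp add: KL_support_def)
qed

end
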